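(* Let $X$ be an $L$-algebra such that $x\cdot(y\cdot z)=y\cdot(x\cdot z)$ for all $x,y,z\in X$, and let $I$ be an ideal of $X$. Then the maps $P\mapsto I\cdot P$ and $Q\cap I\mapsfrom Q$ give a bijective correspondence (are mutually inverse bijections) between the prime ideals $P$ of the $L$-algebra $I$ and the prime ideals $Q$ of $X$ in the open set $U_I=\{Q\in\mathrm{Spec}\,X\mid I\not\subseteq Q\}$.
   Context: An $L$-algebra is a set $X$ with a binary operation $(x,y)\mapsto x\cdot y$ and an element $1\in X$ such that for all $x,y,z\in X$: (i) $x\cdot x=x\cdot 1=1$ and $1\cdot x=x$; (ii) $(x\cdot y)\cdot(x\cdot z)=(y\cdot x)\cdot(y\cdot z)$; (iii) $x\cdot y=y\cdot x=1$ implies $x=y$. An ideal of $X$ is a subset $I\subseteq X$ with $1\in I$ such that for all $x,y\in X$: if $x\in I$ and $x\cdot y\in I$, then $y\in I$; if $x\in I$, then $(x\cdot y)\cdot y\in I$; if $x\in I$, then $y\cdot x\in I$ and $y\cdot(x\cdot y)\in I$. An ideal is closed under the operation and is regarded as an $L$-algebra with the induced operation. For subsets $I,P$ of $X$ with $I$ an ideal, $I\cdot P:=\{x\in X\mid\langle x\rangle\cap I\subseteq P\}$, where $\langle x\rangle$ is the ideal of $X$ generated by $x$; when $P$ is an ideal of $X$, $I\cdot P$ is the greatest ideal $K$ of $X$ with $K\cap I\subseteq P$. An ideal $P$ of an $L$-algebra $Y$ is prime if $P\neq Y$ and for every ideal $J$ of $Y$ either $J\subseteq P$ or $J\cdot P\subseteq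 P$, where $J\cdot P$ is formed in $Y$ (equivalently, for all ideals $J,K$ of $Y$, $J\cap K\subseteq P$ implies $J\subseteq P$ or $K\subseteq P$). $\mathrm{Spec}\,Y$ is the set of prime ideals of $Y$, with open sets $U_J=\{P\in\mathrm{Spec}\,Y\mid J\not\subseteq P\}$ for ideals $J$ of $Y$. *)

theory Defs
  imports Main
begin

locale L_algebra =
  fixes X :: "'a set" and dot :: "'a \<Rightarrow> 'a \<Rightarrow> 'a" (infixr "\<cdot>" 70) and one :: 'a ("\<one>")
  assumes dot_closed: "\<lbrakk>x \<in> X; y \<in> X\<rbrakk> \<Longrightarrow> x \<cdot> y \<in> X"
    and one_closed: "\<one> \<in> X"
    and dot_self: "x \<in> X \<Longrightarrow> x \<cdot> x = \<one>"
    and dot_one: "x \<in> X \<Longrightarrow> x \<cdot> \<one> = \<one>"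
    and one_dot: "x \<in> X \<Longrightarrow> \<one> \<cdot> x = x"
    and cycloid: "\<lbrakk>x \<in> X; y \<in> X; z \<in> X\<rbrakk> \<Longrightarrow> (x \<cdot> y) \<cdot> (x \<cdot> z) = (y \<cdot> x) \<cdot> (y \<cdot> z)"
    and antisym: "\<lbrakk>x \<in> X; y \<in> X; x \<cdot> y = \<one>; y \<cdot> x = \<one>\<rbrakk> \<Longrightarrow> x = y"

text \<open>
  The following notions take the carrier, the operation and the unit as explicit arguments,
  so that an ideal \<open>I\<close> of \<open>X\<close> is turned into an L-algebra by replacing the carrier \<open>X\<close> by \<open>I\<close>.
\<close>

definition L_ideal :: "'a set \<Rightarrow> ('a \<Rightarrow> 'a \<Rightarrow> 'a) \<Rightarrow> 'a \<Rightarrow> 'a set \<Rightarrow> bool" where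
  "L_ideal X dot one I \<longleftrightarrow>
     I \<subseteq> X \<and> one \<in> I \<and>
     (\<forall>x\<in>X. \<forall>y\<in>X.
        (x \<in> I \<and> dot x y \<in> I \<longrightarrow> y \<in> I) \<and>
        (x \<in> I \<longrightarrow> dot (dot x y) y \<in> I) \<and>
        (x \<in> I \<longrightarrow> dot y x \<in> I \<and> dot y (dot x y) \<in> I))"

definition gen_ideal :: "'a set \<Rightarrow> ('a \<Rightarrow> 'a \<Rightarrow> 'a) \<Rightarrow> 'a \<Rightarrow> 'a \<Rightarrow> 'a set" where
  "gen_ideal X dot one x = \<Inter> {J. L_ideal X dot one J \<and> x \<in> J}"

text \<open>\<open>ideal_dot X dot one I P\<close> is the set \<open>I \<cdot> P\<close>, formed in \<open>X\<close>.\<close>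

definition ideal_dot ::
  "'a set \<Rightarrow> ('a \<Rightarrow> 'a \<Rightarrow> 'a) \<Rightarrow> 'a \<Rightarrow> 'a set \<Rightarrow> 'a set \<Rightarrow> 'a set" where
  "ideal_dot X dot one I P = {x \<in> X. gen_ideal X dot one x \<inter> I \<subseteq> P}"

definition prime_L_ideal :: "'a set \<Rightarrow> ('a \<Rightarrow> 'a \<Rightarrow> 'a) \<Rightarrow> 'a \<Rightarrow> 'a set \<Rightarrow> bool" where
  "prime_L_ideal Y dot one P \<longleftrightarrow>
     L_ideal Y dot one P \<and> P \<noteq> Y \<and>
     (\<forall>J. L_ideal Y dot one J \<longrightarrow> J \<subseteq> P \<or> ideal_dot Y dot one J P \<subseteq> P)"

definition L_Spec :: "'a set \<Rightarrow> ('a \<Rightarrow> 'a \<Rightarrow> 'a) \<Rightarrow> 'a \<Rightarrow> 'a set set" where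
  "L_Spec Y dot one = {P. prime_L_ideal Y dot one P}"

definition Spec_open :: "'a set \<Rightarrow> ('a \<Rightarrow> 'a \<Rightarrow> 'a) \<Rightarrow> 'a \<Rightarrow> 'a set \<Rightarrow> 'a set set" where
  "Spec_open Y dot one J = {P \<in> L_Spec Y dot one. \<not> J \<subseteq> P}"

lemma (in L_algebra) L_ideal_imp_L_algebra:
  assumes "L_ideal X dot one I"
  shows "L_algebra I dot one"
proof -
  have "I \<subseteq> X" "\<one> \<in> I" "\<And>x y. \<lbrakk>x \<in> I; y \<in> I\<rbrakk> \<Longrightarrow> x \<cdot> y \<in> I"
    using assms unfolding L_ideal_def by blast+
  then show ?thesis
    by unfold_locales (auto intro: dot_self dot_one one_dot cycloid antisym)
qed

end

theory Submission
  imports Defs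
begin

text \<open>
  In the presence of the exchange law, ideals are just deductive filters (closed under modus ponens),
  so ideals of \<open>I\<close> are ideals of \<open>X\<close>. The decisive point is that \<open>I \<cdot> P\<close> is an
  ideal: it coincides with the set of all \<open>a\<close> such that \<open>a \<cdot> z \<in> P\<close> implies \<open>z \<in> P\<close> for
  \<open>z \<in> I\<close>, and this set is closed under modus ponens because
  \<open>(b \<cdot> z) \<cdot> ((a \<cdot> b) \<cdot> (a \<cdot> z)) = \<one>\<close>.
\<close>

locale CL_algebra = L_algebra +
  assumes exchange: "\<lbrakk>x \<in> X; y \<in> X; z \<in> X\<rbrakk> \<Longrightarrow> x \<cdot> (y \<cdot> z) = y \<cdot> (x \<cdot> z)"
begin

abbreviation ideal :: "'a set \<Rightarrow> bool" where
  "ideal \<equiv> L_ideal X (\<cdot>) \<one>"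

abbreviation gen :: "'a \<Rightarrow> 'a set" where
  "gen \<equiv> gen_ideal X (\<cdot>) \<one>"

abbreviation residual :: "'a set \<Rightarrow> 'a set \<Rightarrow> 'a set" where
  "residual \<equiv> ideal_dot X (\<cdot>) \<one>"

lemma dot_weaken: "\<lbrakk>x \<in> X; y \<in> X\<rbrakk> \<Longrightarrow> x \<cdot> (y \<cdot> x) = \<one>"
  using exchange[of x y x] by (simp add: dot_self dot_one)

lemma dot_dot_ge: "\<lbrakk>x \<in> X; y \<in> X\<rbrakk> \<Longrightarrow> x \<cdot> ((x \<cdot> y) \<cdot> y) = \<one>"
  using exchange[of x "x \<cdot> y" y] by (simp add: dot_self dot_closed)

text \<open>With \<open>\<cdot>\<close> read as implication this is the prefixing law; the cycloid
  equation reduces it to weakening.\<close>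

lemma dot_prefix:
  assumes "a \<in> X" "b \<in> X" "c \<in> X"
  shows "(b \<cdot> c) \<cdot> ((a \<cdot> b) \<cdot> (a \<cdot> c)) = \<one>"
proof -
  have "(b \<cdot> c) \<cdot> ((a \<cdot> b) \<cdot> (a \<cdot> c)) = (b \<cdot> c) \<cdot> ((b \<cdot> a) \<cdot> (b \<cdot> c))"
    using assms by (simp add: cycloid)
  also have "\<dots> = \<one>"
    using assms by (simp add: dot_weaken dot_closed)
  finally show ?thesis .
qed

text \<open>Modus ponens yields the other closure conditions: by \<open>dot_dot_ge\<close> and
  \<open>dot_weaken\<close>, \<open>x\<close> implies both \<open>(x \<cdot> y) \<cdot> y\<close>
  and \<open>y \<cdot> x\<close>, while \<open>y \<cdot> (x \<cdot> y)\<close> is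
  \<open>\<one>\<close> itself.\<close>

lemma ideal_iff:
  "ideal J \<longleftrightarrow> J \<subseteq> X \<and> \<one> \<in> J \<and> (\<forall>x\<in>J. \<forall>y\<in>X. x \<cdot> y \<in> J \<longrightarrow> y \<in> J)"
  (is "_ \<longleftrightarrow> ?filter")
proof
  assume ?filter
  then have sub: "J \<subseteq> X" and one: "\<one> \<in> J"
    and mp: "\<And>x y. \<lbrakk>x \<in> J; x \<cdot> y \<in> J; y \<in> X\<rbrakk> \<Longrightarrow> y \<in> J"
    by blast+
  have "(x \<cdot> y) \<cdot> y \<in> J" "y \<cdot> x \<in> J" "y \<cdot> (x \<cdot> y) \<in> J" if "x \<in> J" "y \<in> X" for x y
  proof -
    have "x \<in> X" using that sub by blast
    then show "(x \<cdot> y) \<cdot> y \<in> J" "y \<cdot> x \<in> J" "y \<cdot> (x \<cdot> y) \<in> J"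
      using that one mp[of x "(x \<cdot> y) \<cdot> y"] mp[of x "y \<cdot> x"]
      by (simp_all add: dot_dot_ge dot_weaken dot_closed)
  qed
  moreover have "\<forall>x\<in>X. \<forall>y\<in>X. x \<in> J \<and> x \<cdot> y \<in> J \<longrightarrow> y \<in> J"
    using mp by blast
  ultimately show "ideal J"
    using sub one unfolding L_ideal_def by (intro conjI ballI impI) blast+
qed (unfold L_ideal_def, blast)

lemma ideal_subset: "ideal J \<Longrightarrow> J \<subseteq> X"
  unfolding L_ideal_def by blast

lemma ideal_mp: "\<lbrakk>ideal J; x \<in> J; x \<cdot> y \<in> J; y \<in> X\<rbrakk> \<Longrightarrow> y \<in> J"
  unfolding ideal_iff by blast

lemma ideal_one: "ideal J \<Longrightarrow> \<one> \<in> J"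
  unfolding ideal_iff by blast

lemma ideal_dot_right: "\<lbrakk>ideal J; x \<in> J; y \<in> X\<rbrakk> \<Longrightarrow> y \<cdot> x \<in> J"
  unfolding L_ideal_def by blast

lemma ideal_dot_dot: "\<lbrakk>ideal J; x \<in> J; y \<in> X\<rbrakk> \<Longrightarrow> (x \<cdot> y) \<cdot> y \<in> J"
  unfolding L_ideal_def by blast

lemma ideal_Int: "\<lbrakk>ideal J; ideal K\<rbrakk> \<Longrightarrow> ideal (J \<inter> K)"
  unfolding ideal_iff by blast

lemma mem_gen: "x \<in> gen x"
  by (auto simp: gen_ideal_def)

lemma gen_subset: "\<lbrakk>ideal J; x \<in> J\<rbrakk> \<Longrightarrow> gen x \<subseteq> J"
  by (auto simp: gen_ideal_def)

lemma ideal_carrier: "ideal X"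
  by (auto simp: ideal_iff one_closed)

lemma ideal_gen:
  assumes "x \<in> X" shows "ideal (gen x)"
proof -
  \<comment> \<open>Here \<open>x \<in> X\<close> matters: it puts \<open>X\<close> into the
    intersected family, which would otherwise be empty with the whole type as its
    intersection.\<close>
  have "gen x \<subseteq> X"
    using assms ideal_carrier by (rule gen_subset[rotated])
  moreover have "\<one> \<in> gen x"
    by (simp add: gen_ideal_def ideal_one)
  moreover have "b \<in> gen x" if "a \<in> gen x" "a \<cdot> b \<in> gen x" "b \<in> X" for a b
    using that ideal_mp[of _ a b] by (auto simp: gen_ideal_def)
  ultimately show ?thesis
    unfolding ideal_iff by blast
qed

lemma residual_eq:
  assumes I: "ideal I" and P: "ideal P"
  shows "residual I P = {a \<in> X. \<forall>z\<in>I. a \<cdot> z \<in> P \<longrightarrow> z \<in> P}" (is "_ = ?F")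
    and ideal_residual: "ideal (residual I P)"
proof -
  \<comment> \<open>This comes first because the inclusion of \<open>?F\<close> in the residual
    rests on \<open>gen x \<subseteq> ?F\<close>.\<close>
  have F: "ideal ?F"
    unfolding ideal_iff
  proof (intro conjI ballI impI)
    show "\<one> \<in> ?F"
      using ideal_subset[OF I] by (auto simp: one_closed one_dot)
    fix a b assume a: "a \<in> ?F" and b: "b \<in> X" and ab: "a \<cdot> b \<in> ?F"
    have "z \<in> P" if z: "z \<in> I" and bz: "b \<cdot> z \<in> P" for z
    proof -
      have aX: "a \<in> X" and zX: "z \<in> X" using a z ideal_subset[OF I] by auto
      have "(b \<cdot> z) \<cdot> ((a \<cdot> b) \<cdot> (a \<cdot> z)) \<in> P"
        using dot_prefix[OF aX b zX] ideal_one[OF P] by simp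
      then have "(a \<cdot> b) \<cdot> (a \<cdot> z) \<in> P"
        using ideal_mp[OF P bz] aX b zX by (simp add: dot_closed)
      moreover have "a \<cdot> z \<in> I" using ideal_dot_right[OF I z aX] .
      ultimately have "a \<cdot> z \<in> P" using ab by blast
      then show "z \<in> P" using a z by blast
    qed
    then show "b \<in> ?F" using b by blast
  qed auto
  show eq: "residual I P = ?F"
  proof (intro equalityI subsetI)
    fix x assume "x \<in> residual I P"
    then have x: "x \<in> X" and sub: "gen x \<inter> I \<subseteq> P" by (auto simp: ideal_dot_def)
    have "z \<in> P" if z: "z \<in> I" and xz: "x \<cdot> z \<in> P" for z
    proof -
      have zX: "z \<in> X" using z ideal_subset[OF I] by blast
      \<comment> \<open>The element \<open>(x \<cdot> z) \<cdot> z\<close> lies above both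
        \<open>x\<close> and \<open>z\<close>, hence in \<open>gen x \<inter> I\<close> and so in
        \<open>P\<close>; modus ponens with \<open>x \<cdot> z\<close> then gives
        \<open>z\<close>.\<close>
      have "(x \<cdot> z) \<cdot> z \<in> gen x"
        using ideal_dot_dot[OF ideal_gen[OF x] mem_gen zX] .
      moreover have "(x \<cdot> z) \<cdot> z \<in> I"
        using ideal_dot_right[OF I z] x zX by (simp add: dot_closed)
      ultimately show "z \<in> P" using sub ideal_mp[OF P xz _ zX] by blast
    qed
    then show "x \<in> ?F" using x by blast
  next
    fix x assume x: "x \<in> ?F"
    \<comment> \<open>The condition defining \<open>?F\<close> is tested on \<open>z\<close> itself,
      where \<open>z \<cdot> z = \<one>\<close>.\<close>
    have "z \<in> P" if "z \<in> ?F" "z \<in> I" for z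
      using that ideal_one[OF P] by (auto simp: dot_self)
    then have "gen x \<inter> I \<subseteq> P" using gen_subset[OF F x] by blast
    then show "x \<in> residual I P" using x by (auto simp: ideal_dot_def)
  qed
  show "ideal (residual I P)" using F by (simp only: eq)
qed

text \<open>This is the adjunction of Heyting implication, valid because an ideal contains
  \<open>gen x\<close> for each of its elements \<open>x\<close>. It lets the primeness arguments
  work with ideals instead of elements.\<close>

lemma subset_residual_iff:
  assumes "ideal K"
  shows "K \<subseteq> residual I P \<longleftrightarrow> K \<inter> I \<subseteq> P"
  using gen_subset[OF assms] ideal_subset[OF assms] mem_gen
  unfolding ideal_dot_def by blast

lemma residual_Int_self: "residual I (P \<inter> I) = residual I P"
  by (auto simp: ideal_dot_def)

context
  fixes I assumes I: "ideal I"
begin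

lemma CL_algebra_ideal: "CL_algebra I (\<cdot>) \<one>"
proof -
  interpret sub: L_algebra I "(\<cdot>)" \<one>
    using L_ideal_imp_L_algebra[OF I] .
  show ?thesis
    using ideal_subset[OF I] by unfold_locales (auto intro: exchange)
qed

interpretation sub: CL_algebra I "(\<cdot>)" \<one>
  by (rule CL_algebra_ideal)

text \<open>Being an ideal is transitive: if \<open>x\<close> and \<open>x \<cdot> y\<close> lie in
  \<open>J \<subseteq> I\<close>, then modus ponens in \<open>I\<close> already forces
  \<open>y \<in> I\<close>, so it makes no difference whether \<open>y\<close> ranges over
  \<open>X\<close> or \<open>I\<close>.\<close>

lemma ideal_of_ideal_iff: "sub.ideal J \<longleftrightarrow> ideal J \<and> J \<subseteq> I"
proof -
  have "y \<in> I" if "J \<subseteq> I" "x \<in> J" "y \<in> X" "x \<cdot> y \<in> J" for x y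
    using ideal_mp[OF I, of x y] that by blast
  then show ?thesis
    using ideal_subset[OF I] unfolding ideal_iff sub.ideal_iff by blast
qed

lemma gen_ideal_of_ideal:
  assumes "x \<in> I" shows "sub.gen x = gen x"
proof
  have "x \<in> X" using assms ideal_subset[OF I] by blast
  then have "sub.ideal (gen x)"
    using ideal_gen gen_subset[OF I assms] by (simp add: ideal_of_ideal_iff)
  then show "sub.gen x \<subseteq> gen x"
    using mem_gen by (rule sub.gen_subset)
  show "gen x \<subseteq> sub.gen x"
    using sub.ideal_gen[OF assms] sub.mem_gen by (intro gen_subset) (auto simp: ideal_of_ideal_iff)
qed

lemma residual_of_ideal: "sub.residual J P = residual J P \<inter> I"
  using ideal_subset[OF I] by (auto simp: ideal_dot_def gen_ideal_of_ideal)

lemma residual_Int: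
  assumes "ideal P" "P \<subseteq> I" shows "residual I P \<inter> I = P"
proof
  have "ideal (residual I P)" using ideal_residual[OF I assms(1)] .
  then show "residual I P \<inter> I \<subseteq> P" using subset_residual_iff by blast
  show "P \<subseteq> residual I P \<inter> I" using assms subset_residual_iff[OF assms(1)] by blast
qed

lemma residual_prime:
  assumes "P \<in> L_Spec I (\<cdot>) \<one>"
  shows "residual I P \<inter> I = P" and "residual I P \<in> Spec_open X (\<cdot>) \<one> I"
proof -
  have P: "ideal P" "P \<subseteq> I" "P \<noteq> I"
    and prime: "\<And>J. \<lbrakk>ideal J; J \<subseteq> I\<rbrakk> \<Longrightarrow> J \<subseteq> P \<or> residual J P \<inter> I \<subseteq> P"
    using assms
    by (auto simp: L_Spec_def prime_L_ideal_def ideal_of_ideal_iff residual_of_ideal)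
  show res: "residual I P \<inter> I = P" using P by (intro residual_Int)
  \<comment> \<open>Used twice: for membership in the open set and, since
    \<open>I \<subseteq> X\<close>, for properness.\<close>
  have not_sub: "\<not> I \<subseteq> residual I P" using res P by blast
  have "residual J (residual I P) \<subseteq> residual I P" if J: "ideal J" "\<not> J \<subseteq> residual I P" for J
  proof -
    let ?K = "residual J (residual I P)"
    have K: "ideal ?K"
      using ideal_residual[OF J(1) ideal_residual[OF I P(1)]] .
    then have "?K \<inter> J \<subseteq> residual I P" by (simp flip: subset_residual_iff)
    \<comment> \<open>Intersecting with \<open>I\<close> moves the question into \<open>I\<close>,
      where primeness of \<open>P\<close> applies to the trace \<open>J \<inter> I\<close>. The goal
      is \<open>?K \<inter> I \<subseteq> P\<close>, which the adjunction turns back into a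
      statement about \<open>?K\<close>.\<close>
    then have "?K \<inter> I \<inter> (J \<inter> I) \<subseteq> P" using res by blast
    then have "?K \<inter> I \<subseteq> residual (J \<inter> I) P"
      using ideal_Int[OF K I] by (simp add: subset_residual_iff)
    moreover have "\<not> J \<inter> I \<subseteq> P" using J by (simp add: subset_residual_iff)
    then have "residual (J \<inter> I) P \<inter> I \<subseteq> P"
      using prime[of "J \<inter> I"] ideal_Int[OF J(1) I] by blast
    ultimately show ?thesis
      using K by (auto simp: subset_residual_iff)
  qed
  then show "residual I P \<in> Spec_open X (\<cdot>) \<one> I"
    using ideal_residual[OF I P(1)] not_sub ideal_subset[OF I]
    unfolding Spec_open_def L_Spec_def prime_L_ideal_def by blast
qed

lemma Int_prime:
  assumes "Q \<in> Spec_open X (\<cdot>) \<one> I"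
  shows "residual I (Q \<inter> I) = Q" and "Q \<inter> I \<in> L_Spec I (\<cdot>) \<one>"
proof -
  have Q: "ideal Q" "\<not> I \<subseteq> Q"
    and prime: "\<And>J. ideal J \<Longrightarrow> J \<subseteq> Q \<or> residual J Q \<subseteq> Q"
    using assms by (auto simp: Spec_open_def L_Spec_def prime_L_ideal_def)
  have "Q \<subseteq> residual I Q" using Q by (simp add: subset_residual_iff)
  \<comment> \<open>Primeness of \<open>Q\<close> is tested on \<open>I\<close> itself: as
    \<open>I\<close> is not inside \<open>Q\<close>,
    \<open>residual I Q \<subseteq> Q\<close>.\<close>
  then show "residual I (Q \<inter> I) = Q" using prime[OF I] Q by (auto simp: residual_Int_self)
  have "J \<subseteq> Q \<inter> I \<or> residual J (Q \<inter> I) \<inter> I \<subseteq> Q \<inter> I" if J: "ideal J" "J \<subseteq> I" for J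
  proof -
    have "residual J (Q \<inter> I) \<subseteq> residual J Q" by (auto simp: ideal_dot_def)
    then show ?thesis using prime[OF J(1)] J(2) by blast
  qed
  then show "Q \<inter> I \<in> L_Spec I (\<cdot>) \<one>"
    using Q ideal_Int[OF Q(1) I]
    by (auto simp: L_Spec_def prime_L_ideal_def ideal_of_ideal_iff residual_of_ideal)
qed

end

end

theorem theorem6:
  fixes X :: "'a set" and dot :: "'a \<Rightarrow> 'a \<Rightarrow> 'a" and one :: 'a and I :: "'a set"
  assumes "L_algebra X dot one"
    and "\<And>x y z. \<lbrakk>x \<in> X; y \<in> X; z \<in> X\<rbrakk> \<Longrightarrow> dot x (dot y z) = dot y (dot x z)"
    and "L_ideal X dot one I"
  shows "bij_betw (\<lambda>P. ideal_dot X dot one I P) (L_Spec I dot one) (Spec_open X dot one I) \<and>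
    bij_betw (\<lambda>Q. Q \<inter> I) (Spec_open X dot one I) (L_Spec I dot one) \<and>
    (\<forall>P \<in> L_Spec I dot one. ideal_dot X dot one I P \<inter> I = P) \<and>
    (\<forall>Q \<in> Spec_open X dot one I. ideal_dot X dot one I (Q \<inter> I) = Q)"
proof -
  interpret CL_algebra X dot one
    using assms(1,2) by (simp add: CL_algebra_def CL_algebra_axioms_def)
  \<comment> \<open>These supply both composites and both ranges, so each map witnesses the
    bijectivity of the other.\<close>
  note P = residual_prime[OF assms(3)] and Q = Int_prime[OF assms(3)]
  have "bij_betw (residual I) (L_Spec I dot one) (Spec_open X dot one I)"
    by (rule bij_betw_byWitness[where f' = "\<lambda>Q. Q \<inter> I"]) (use P Q in auto)
  moreover have "bij_betw (\<lambda>Q. Q \<inter> I) (Spec_open X dot one I) (L_Spec I dot one)"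
    by (rule bij_betw_byWitness[where f' = "residual I"]) (use P Q in auto)
  ultimately show ?thesis using P(1) Q(1) by blast
qed

end
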